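(* Let $\mathcal{H}$ be a complex Hilbert space, let $\alpha,\beta$ be real numbers with $0\leq\alpha\leq 1\leq\beta$, and let $T\in B(\mathcal{H})$ be an $(\alpha,\beta)$-normal operator. Then $$w(T)^{2}\leq \frac{1}{2}\left[\beta\,\|T\|^{2}+w(T^{2})\right].$$
   Context: $B(\mathcal{H})$ denotes the algebra of bounded linear operators on the complex Hilbert space $(\mathcal{H};\langle\cdot,\cdot\rangle)$, and $\|\cdot\|$ denotes the operator norm. For real numbers $0\leq\alpha\leq 1\leq\beta$, an operator $T\in B(\mathcal{H})$ is called $(\alpha,\beta)$-normal if $\alpha^{2}T^{*}T\leq TT^{*}\leq\beta^{2}T^{*}T$ in the usual (Loewner) order of self-adjoint operators. The numerical radius of $T\in B(\mathcal{H})$ is $w(T)=\sup\{|\langle Tx,x\rangle| : x\in\mathcal{H},\ \|x\|=1\}$. *)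

theory Defs
  imports "HOL-Analysis.Analysis"
begin

text \<open>
  Complex vector spaces, inner product spaces and Hilbert spaces, as refinements of the real
  classes: the real scalar multiplication is the restriction of the complex one, and the norm
  (hence the metric and the topology) is the one induced by the complex inner product.
  The zero space is not excluded.
\<close>

class complex_vector = real_vector +
  fixes scaleC :: "complex \<Rightarrow> 'a \<Rightarrow> 'a" (infixr \<open>*\<^sub>C\<close> 75)
  assumes scaleC_add_right: "a *\<^sub>C (x + y) = a *\<^sub>C x + a *\<^sub>C y"
    and scaleC_add_left: "(a + b) *\<^sub>C x = a *\<^sub>C x + b *\<^sub>C x"
    and scaleC_scaleC: "a *\<^sub>C b *\<^sub>C x = (a * b) *\<^sub>C x"
    and scaleC_one: "1 *\<^sub>C x = x"
    and scaleR_scaleC: "r *\<^sub>R x = complex_of_real r *\<^sub>C x"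

text \<open>The inner product is linear in the first and conjugate-linear in the second argument.\<close>

class complex_inner = complex_vector + real_normed_vector +
  fixes cinner :: "'a \<Rightarrow> 'a \<Rightarrow> complex"
  assumes cinner_commute: "cinner x y = cnj (cinner y x)"
    and cinner_add_left: "cinner (x + y) z = cinner x z + cinner y z"
    and cinner_scaleC_left: "cinner (c *\<^sub>C x) y = c * cinner x y"
    and cinner_ge_zero: "0 \<le> Re (cinner x x)"
    and cinner_eq_zero_iff: "cinner x x = 0 \<longleftrightarrow> x = 0"
    and norm_eq_sqrt_cinner: "norm x = sqrt (Re (cinner x x))"

class chilbert_space = complex_inner + complete_space

instantiation complex :: chilbert_space
begin

definition "scaleC_complex (c :: complex) (x :: complex) = c * x"

definition "cinner_complex (x :: complex) (y :: complex) = x * cnj y"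

instance
  by standard
    (auto simp: scaleC_complex_def cinner_complex_def algebra_simps scaleR_conv_of_real
      cmod_def power2_eq_square)

end

definition bounded_clinear :: "('a::complex_inner \<Rightarrow> 'a) \<Rightarrow> bool" where
  "bounded_clinear T \<longleftrightarrow> bounded_linear T \<and> (\<forall>c x. T (c *\<^sub>C x) = c *\<^sub>C T x)"

text \<open>
  For a bounded operator on a Hilbert space, the function described here exists by the Riesz
  representation theorem, is unique, and is again a bounded complex-linear operator.
\<close>

definition cadjoint :: "('a::chilbert_space \<Rightarrow> 'a) \<Rightarrow> 'a \<Rightarrow> 'a" where
  "cadjoint T = (THE S. \<forall>x y. cinner (T x) y = cinner x (S y))"

definition loewner_le :: "('a::complex_inner \<Rightarrow> 'a) \<Rightarrow> ('a \<Rightarrow> 'a) \<Rightarrow> bool" where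
  "loewner_le A B \<longleftrightarrow>
     (\<forall>x. cinner (B x - A x) x \<in> \<real> \<and> 0 \<le> Re (cinner (B x - A x) x))"

definition alpha_beta_normal :: "real \<Rightarrow> real \<Rightarrow> ('a::chilbert_space \<Rightarrow> 'a) \<Rightarrow> bool" where
  "alpha_beta_normal \<alpha> \<beta> T \<longleftrightarrow>
     loewner_le (\<lambda>x. \<alpha>\<^sup>2 *\<^sub>R cadjoint T (T x)) (\<lambda>x. T (cadjoint T x)) \<and>
     loewner_le (\<lambda>x. T (cadjoint T x)) (\<lambda>x. \<beta>\<^sup>2 *\<^sub>R cadjoint T (T x))"

text \<open>
  All values \<open>cmod (cinner (T x) x)\<close> are nonnegative, so adjoining \<open>0\<close> matters only for the
  zero space, which has no unit vectors; it makes the numerical radius \<open>0\<close> there.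
\<close>

definition numerical_radius :: "('a::complex_inner \<Rightarrow> 'a) \<Rightarrow> real" where
  "numerical_radius T = Sup (insert 0 {cmod (cinner (T x) x) | x. norm x = 1})"

end

theory Submission
  imports Defs
begin

text \<open>
  For a unit vector \<open>x\<close>, Buzano's inequality
  \<open>2 |\<langle>a,x\<rangle>\<langle>x,b\<rangle>| \<le> |\<langle>a,b\<rangle>| + \<parallel>a\<parallel> \<parallel>b\<parallel>\<close> with \<open>a = T x\<close> and \<open>b = T\<^sup>* x\<close> reads
  \<open>2 |\<langle>T x,x\<rangle>|\<^sup>2 \<le> |\<langle>T\<^sup>2 x,x\<rangle>| + \<parallel>T x\<parallel> \<parallel>T\<^sup>* x\<parallel>\<close>, and \<open>T T\<^sup>* \<le> \<beta>\<^sup>2 T\<^sup>* T\<close> means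
  \<open>\<parallel>T\<^sup>* x\<parallel> \<le> \<beta> \<parallel>T x\<parallel>\<close>. The adjoint exists by the Riesz representation theorem, which is obtained
  by minimising \<open>\<parallel>u\<parallel>\<^sup>2 - 2 Re (f u)\<close>.
\<close>

section \<open>Inner product calculus, the Cauchy-Schwarz and Buzano inequalities\<close>

lemma cinner_add_right: "cinner x (y + z) = cinner x y + cinner (x::'a::complex_inner) z"
  by (metis cinner_add_left cinner_commute complex_cnj_add)

lemma cinner_scaleC_right: "cinner x (c *\<^sub>C y) = cnj c * cinner (x::'a::complex_inner) y"
  by (metis cinner_commute cinner_scaleC_left complex_cnj_mult)

lemma cinner_scaleR_left: "cinner (r *\<^sub>R x) y = of_real r * cinner (x::'a::complex_inner) y"
  by (simp add: scaleR_scaleC cinner_scaleC_left)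

lemma cinner_scaleR_right: "cinner x (r *\<^sub>R y) = of_real r * cinner (x::'a::complex_inner) y"
  by (simp add: scaleR_scaleC cinner_scaleC_right)

lemma cinner_diff_left: "cinner (x - y) z = cinner x z - cinner (y::'a::complex_inner) z"
  by (metis add_diff_cancel cinner_add_left diff_add_cancel)

lemma cinner_diff_right: "cinner x (y - z) = cinner x y - cinner (x::'a::complex_inner) z"
  by (metis add_diff_cancel cinner_add_right diff_add_cancel)

lemma cinner_self: "cinner x x = of_real ((norm (x::'a::complex_inner))\<^sup>2)"
proof -
  have "Im (cinner x x) = 0"
    using cinner_commute[of x x] by (simp add: complex_eq_iff)
  then show ?thesis
    by (simp add: complex_eq_iff norm_eq_sqrt_cinner cinner_ge_zero)
qed

lemma norm_add_square:
  "(norm (x + y))\<^sup>2 = (norm x)\<^sup>2 + 2 * Re (cinner x y) + (norm (y::'a::complex_inner))\<^sup>2"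
proof -
  have "Re (cinner (x + y) (x + y)) = Re (cinner x x) + 2 * Re (cinner x y) + Re (cinner y y)"
    using cinner_commute[of y x] by (simp add: cinner_add_left cinner_add_right)
  then show ?thesis
    by (simp add: cinner_self del: of_real_power)
qed

lemma norm_scaleC: "norm (c *\<^sub>C x) = cmod c * norm (x::'a::complex_inner)"
proof -
  have "complex_of_real ((norm (c *\<^sub>C x))\<^sup>2) = (c * cnj c) * cinner x x"
    by (simp only: cinner_self[symmetric] cinner_scaleC_left cinner_scaleC_right mult_ac)
  also have "\<dots> = of_real ((cmod c * norm x)\<^sup>2)"
    by (simp only: cinner_self complex_norm_square[symmetric] power_mult_distrib of_real_mult)
  finally have "complex_of_real ((norm (c *\<^sub>C x))\<^sup>2) = of_real ((cmod c * norm x)\<^sup>2)" .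
  then have "(norm (c *\<^sub>C x))\<^sup>2 = (cmod c * norm x)\<^sup>2"
    using of_real_eq_iff by blast
  then show ?thesis
    by (simp add: power2_eq_iff_nonneg)
qed

text \<open>The triangle inequality comes with the class \<open>real_normed_vector\<close>; squaring
  it and cancelling the squared norms leaves the real form of Cauchy-Schwarz.\<close>

lemma Re_cinner_le: "Re (cinner x y) \<le> norm x * norm (y::'a::complex_inner)"
proof -
  have "(norm (x + y))\<^sup>2 \<le> (norm x + norm y)\<^sup>2"
    by (simp add: norm_triangle_ineq power_mono)
  then show ?thesis
    unfolding norm_add_square by (simp add: power2_sum)
qed

lemma cmod_cinner_le: "cmod (cinner x y) \<le> norm x * norm (y::'a::complex_inner)"
proof (cases "cinner x y = 0")
  case False
  \<comment> \<open>Multiplying \<open>x\<close> by this phase rotates the inner product onto the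
    positive real axis, where modulus and real part agree.\<close>
  define c where "c = cnj (cinner x y) / of_real (cmod (cinner x y))"
  have c: "cmod c = 1"
    using False by (simp add: c_def norm_divide)
  have "cinner (c *\<^sub>C x) y = of_real (cmod (cinner x y))"
    using False complex_norm_square[of "cinner x y"]
    by (simp add: cinner_scaleC_left c_def field_simps power2_eq_square)
  then show ?thesis
    using Re_cinner_le[of "c *\<^sub>C x" y] c by (simp add: norm_scaleC)
qed simp

lemma parallelogram_law:
  "(norm (x + y))\<^sup>2 + (norm (x - y))\<^sup>2 = 2 * (norm x)\<^sup>2 + 2 * (norm (y::'a::complex_inner))\<^sup>2"
  using norm_add_square[of x y] norm_add_square[of x "- y"] cinner_diff_right[of x 0 y]
    cinner_diff_right[of x 0 0]
  by simp

text \<open>The vector 2<a,e>e - a is the reflection of \<open>a\<close> in the line spanned by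
  \<open>e\<close>, so it has the norm of \<open>a\<close>. Pairing it with \<open>b\<close> and
  applying Cauchy-Schwarz to that pairing gives the bound.\<close>

lemma Buzano:
  fixes a b e :: "'a::complex_inner"
  assumes "norm e = 1"
  shows "2 * cmod (cinner a e * cinner e b) \<le> cmod (cinner a b) + norm a * norm b"
proof -
  define c where "c = cinner a e"
  define r where "r = (2 * c) *\<^sub>C e - a"
  have "cinner e a = cnj c"
    by (simp add: c_def cinner_commute[of e a])
  then have "cinner r r = cinner a a"
    unfolding r_def using assms
    by (simp add: cinner_diff_left cinner_diff_right cinner_scaleC_left cinner_scaleC_right
        cinner_self[of e] c_def[symmetric])
  then have r: "norm r = norm a"
    by (simp add: norm_eq_sqrt_cinner)
  have "2 * (c * cinner e b) = cinner r b + cinner a b"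
    by (simp add: r_def cinner_diff_left cinner_scaleC_left)
  then have "2 * cmod (c * cinner e b) = cmod (cinner r b + cinner a b)"
    by (metis norm_mult norm_numeral)
  also have "\<dots> \<le> cmod (cinner r b) + cmod (cinner a b)"
    by (rule norm_triangle_ineq)
  finally show ?thesis
    using cmod_cinner_le[of r b] by (simp add: r c_def)
qed

section \<open>Riesz representation and the adjoint\<close>

lemma real_Riesz:
  fixes f :: "'a::chilbert_space \<Rightarrow> real"
  assumes "bounded_linear f"
  shows "\<exists>u. \<forall>x. f x = Re (cinner x u)"
proof -
  interpret f: bounded_linear f by fact
  \<comment> \<open>If \<open>f\<close> is represented by v, then this is the squared distance from
    \<open>u\<close> to v minus the squared norm of v, so a minimiser is the natural candidate for
    v.\<close>
  define \<phi> where "\<phi> u = (norm u)\<^sup>2 - 2 * f u" for u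
  obtain K where K: "\<And>x. norm (f x) \<le> norm x * K"
    using f.bounded by blast
  have "- K\<^sup>2 \<le> \<phi> u" for u
  proof -
    have "f u \<le> norm u * K"
      using K[of u] by simp
    moreover have "0 \<le> (norm u - K)\<^sup>2"
      by simp
    ultimately show ?thesis
      unfolding \<phi>_def power2_diff by simp
  qed
  then have bdd: "bdd_below (range \<phi>)"
    by (meson bdd_belowI2)
  define m where "m = Inf (range \<phi>)"
  have m_le: "m \<le> \<phi> u" for u
    unfolding m_def using bdd by (simp add: cInf_lower)
  have "\<exists>u. \<phi> u < m + 1 / real (Suc n)" for n
  proof -
    have "Inf (range \<phi>) < m + 1 / real (Suc n)"
      by (simp add: m_def)
    then show ?thesis
      using cInf_lessD[of "range \<phi>"] by auto
  qed
  then obtain U where U: "\<And>n. \<phi> (U n) < m + 1 / real (Suc n)"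
    by metis
  \<comment> \<open>The midpoint of \<open>u\<close> and \<open>v\<close> has value at least
    \<open>m\<close>; by the parallelogram law two near-minimisers are then close to each
    other.\<close>
  have dist: "(norm (u - v))\<^sup>2 \<le> 2 * (\<phi> u - m) + 2 * (\<phi> v - m)" for u v
  proof -
    have "\<phi> ((1/2) *\<^sub>R (u + v)) = (norm (u + v))\<^sup>2 / 4 - f u - f v"
      by (simp add: \<phi>_def f.scaleR f.add power_divide add_divide_distrib del: scaleR_add_right)
    then show ?thesis
      using m_le[of "(1/2) *\<^sub>R (u + v)"] parallelogram_law[of u v] by (simp add: \<phi>_def)
  qed
  have "Cauchy U"
  proof (rule metric_CauchyI)
    fix e :: real assume e: "0 < e"
    \<comment> \<open>With both excesses over \<open>m\<close> below a quarter of the square of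
      \<open>e\<close>, the bound \<open>dist\<close> adds up to exactly that square.\<close>
    then obtain N where N: "1 / real (Suc N) < e\<^sup>2 / 4"
      using reals_Archimedean[of "e\<^sup>2 / 4"] by (auto simp: inverse_eq_divide)
    have *: "\<phi> (U n) - m < e\<^sup>2 / 4" if "N \<le> n" for n
    proof -
      have "1 / real (Suc n) \<le> 1 / real (Suc N)"
        using that by (simp add: frac_le)
      then show ?thesis
        using U[of n] N by linarith
    qed
    have "dist (U i) (U j) < e" if "N \<le> i" "N \<le> j" for i j
    proof -
      have "(norm (U i - U j))\<^sup>2 < e\<^sup>2"
        using dist[of "U i" "U j"] *[OF that(1)] *[OF that(2)] by argo
      then show ?thesis
        using e by (simp add: dist_norm power_less_imp_less_base)
    qed
    then show "\<exists>N. \<forall>i\<ge>N. \<forall>j\<ge>N. dist (U i) (U j) < e"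
      by blast
  qed
  then obtain u where u: "U \<longlonglongrightarrow> u"
    using Cauchy_convergent convergent_def by blast
  have lim_\<phi>: "(\<lambda>n. \<phi> (U n)) \<longlonglongrightarrow> \<phi> u"
    unfolding \<phi>_def by (intro tendsto_intros u f.tendsto)
  have lim_m: "(\<lambda>n. m + 1 / real (Suc n)) \<longlonglongrightarrow> m"
    using tendsto_add[OF tendsto_const[of m] LIMSEQ_inverse_real_of_nat]
    by (simp add: inverse_eq_divide)
  have "\<phi> u \<le> m"
    by (rule LIMSEQ_le[OF lim_\<phi> lim_m]) (use U less_imp_le in blast)
  have "f x = Re (cinner x u)" for x
  proof (cases "x = 0")
    case False
    \<comment> \<open>Here \<open>g\<close> is half the derivative of \<open>\<phi>\<close> at
      \<open>u\<close> in direction \<open>x\<close>, and \<open>t\<close> minimises the quadratic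
      by which \<open>\<phi>\<close> changes along that direction. Since \<open>u\<close> is already
      a minimiser, \<open>g\<close> must vanish.\<close>
    define g where "g = Re (cinner u x) - f x"
    define t where "t = - g / (norm x)\<^sup>2"
    have "\<phi> (u + t *\<^sub>R x) - \<phi> u = t\<^sup>2 * (norm x)\<^sup>2 + 2 * t * g"
      unfolding \<phi>_def norm_add_square f.add f.scaleR cinner_scaleR_right g_def
      by (simp add: power_mult_distrib right_diff_distrib)
    also have "\<dots> = - g\<^sup>2 / (norm x)\<^sup>2"
      using False by (simp add: t_def field_simps power2_eq_square)
    finally have "g\<^sup>2 / (norm x)\<^sup>2 \<le> 0"
      using m_le[of "u + t *\<^sub>R x"] \<open>\<phi> u \<le> m\<close> by simp
    then have "g = 0"
      using False by (simp add: divide_le_0_iff)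
    then show ?thesis
      using cinner_commute[of x u] by (simp add: g_def)
  qed (use cinner_diff_left[of 0 0 u] f.zero in simp)
  then show ?thesis by blast
qed

text \<open>A complex-linear functional is determined by its real part: evaluating at
  \<open>\<i> *\<^sub>C x\<close> turns the imaginary part into minus a real part.\<close>

lemma Riesz:
  fixes f :: "'a::chilbert_space \<Rightarrow> complex"
  assumes "bounded_linear f" and f: "\<And>c x. f (c *\<^sub>C x) = c * f x"
  shows "\<exists>u. \<forall>x. f x = cinner x u"
proof -
  have "bounded_linear (\<lambda>x. Re (f x))"
    by (rule bounded_linear_compose[OF bounded_linear_Re assms(1)])
  then obtain u where u: "\<And>x. Re (f x) = Re (cinner x u)"
    using real_Riesz by blast
  have "Im (f x) = Im (cinner x u)" for x
    using u[of "\<i> *\<^sub>C x"] by (simp add: f cinner_scaleC_left)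
  then show ?thesis
    using u by (metis complex_eqI)
qed

text \<open>As \<open>cadjoint\<close> is a definite description, its defining identity requires
  existence (Riesz for each fixed \<open>y\<close>, then choice) and uniqueness.\<close>

lemma cinner_cadjoint:
  fixes T :: "'a::chilbert_space \<Rightarrow> 'a"
  assumes "bounded_clinear T"
  shows "cinner (T x) y = cinner x (cadjoint T y)"
proof -
  interpret T: bounded_linear T
    using assms by (simp add: bounded_clinear_def)
  have "bounded_linear (\<lambda>x. cinner x y)" for y :: 'a
    by (rule bounded_linear_intro[of _ "norm y"])
      (simp_all add: cinner_add_left cinner_scaleR_left cmod_cinner_le scaleR_conv_of_real)
  then have "bounded_linear (\<lambda>x. cinner (T x) y)" for y
    using bounded_linear_compose[of "\<lambda>x. cinner x y" T] T.bounded_linear_axioms by blast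
  moreover have "cinner (T (c *\<^sub>C x)) y = c * cinner (T x) y" for c x y
    using assms by (simp add: bounded_clinear_def cinner_scaleC_left)
  ultimately have "\<exists>u. \<forall>x. cinner (T x) y = cinner x u" for y
    by (intro Riesz)
  then obtain S where S: "\<forall>x y. cinner (T x) y = cinner x (S y)"
    by metis
  have "\<exists>!S. \<forall>x y. cinner (T x) y = cinner x (S y)"
  proof (rule ex1I)
    show "\<forall>x y. cinner (T x) y = cinner x (S y)"
      by (rule S)
    fix S' assume S': "\<forall>x y. cinner (T x) y = cinner x (S' y)"
    \<comment> \<open>The difference of two candidates is orthogonal to every vector, hence to
      itself.\<close>
    have "cinner (S' y - S y) (S' y - S y) = 0" for y
      using S S' unfolding cinner_diff_right[of _ "S' y"] by simp
    then show "S' = S"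
      by (simp add: cinner_eq_zero_iff fun_eq_iff)
  qed
  from theI'[OF this] have "\<forall>x y. cinner (T x) y = cinner x (cadjoint T y)"
    unfolding cadjoint_def .
  then show ?thesis by blast
qed

section \<open>Numerical radius and the final estimate\<close>

lemma cmod_cinner_le_numerical_radius:
  fixes T :: "'a::complex_inner \<Rightarrow> 'a"
  assumes "bounded_linear T" and "norm x = 1"
  shows "cmod (cinner (T x) x) \<le> numerical_radius T"
  unfolding numerical_radius_def
proof (rule cSup_upper)
  have "cmod (cinner (T x) x) \<le> onorm T" if "norm x = 1" for x
    using cmod_cinner_le[of "T x" x] onorm[OF assms(1), of x] that by simp
  then show "bdd_above (insert 0 {cmod (cinner (T x) x) |x. norm x = 1})"
    by (auto intro!: bdd_aboveI)
qed (use assms(2) in blast)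

lemma numerical_radius_le:
  assumes "0 \<le> B" and "\<And>x. norm x = 1 \<Longrightarrow> cmod (cinner (T x) x) \<le> B"
  shows "numerical_radius T \<le> B"
  unfolding numerical_radius_def using assms by (intro cSup_least) auto

lemma numerical_radius_nonneg:
  fixes T :: "'a::complex_inner \<Rightarrow> 'a"
  assumes "bounded_linear T"
  shows "0 \<le> numerical_radius T"
proof (cases "\<exists>x::'a. norm x = 1")
  case True
  then show ?thesis
    using cmod_cinner_le_numerical_radius[OF assms] by (meson norm_ge_zero order_trans)
next
  \<comment> \<open>This is the zero space, where the supremum is taken over the adjoined 0
    alone.\<close>
  case False
  then have "{cmod (cinner (T x) x) |x. norm x = 1} = {}"
    by blast
  then show ?thesis
    by (simp add: numerical_radius_def)
qed

text \<open>Evaluated at \<open>x\<close>, the two quadratic forms in the upper Loewner inequality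
  are the squared norms of \<open>cadjoint T x\<close> and of \<open>T x\<close>, the latter scaled
  by the square of \<open>\<beta>\<close>.\<close>

lemma norm_cadjoint_le:
  fixes T :: "'a::chilbert_space \<Rightarrow> 'a"
  assumes T: "bounded_clinear T" and "0 \<le> \<beta>" and normal: "alpha_beta_normal \<alpha> \<beta> T"
  shows "norm (cadjoint T x) \<le> \<beta> * norm (T x)"
proof -
  have 1: "cinner (T (cadjoint T x)) x = of_real ((norm (cadjoint T x))\<^sup>2)"
    by (simp only: cinner_cadjoint[OF T] cinner_self)
  have "cinner (cadjoint T (T x)) x = cnj (cinner (T x) (T x))"
    by (simp only: cinner_cadjoint[OF T, of x] cinner_commute[of _ x])
  then have 2: "cinner (cadjoint T (T x)) x = of_real ((norm (T x))\<^sup>2)"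
    by (simp only: cinner_self complex_cnj_complex_of_real)
  have "cinner (\<beta>\<^sup>2 *\<^sub>R cadjoint T (T x) - T (cadjoint T x)) x
      = of_real (\<beta>\<^sup>2 * (norm (T x))\<^sup>2 - (norm (cadjoint T x))\<^sup>2)"
    by (simp only: cinner_diff_left cinner_scaleR_left 1 2 of_real_mult of_real_diff)
  moreover have "0 \<le> Re (cinner (\<beta>\<^sup>2 *\<^sub>R cadjoint T (T x) - T (cadjoint T x)) x)"
    using normal unfolding alpha_beta_normal_def loewner_le_def by blast
  ultimately have "(norm (cadjoint T x))\<^sup>2 \<le> (\<beta> * norm (T x))\<^sup>2"
    by (simp only: Re_complex_of_real power_mult_distrib diff_ge_0_iff_ge)
  then show ?thesis
    by (rule power2_le_imp_le) (simp add: assms(2))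
qed

theorem theorem2p2:
  fixes T :: "'a::chilbert_space \<Rightarrow> 'a" and \<alpha> \<beta> :: real
  assumes "0 \<le> \<alpha>" and "\<alpha> \<le> 1" and "1 \<le> \<beta>"
    and "bounded_clinear T"
    and "alpha_beta_normal \<alpha> \<beta> T"
  shows "(numerical_radius T)\<^sup>2 \<le> 1 / 2 * (\<beta> * (onorm T)\<^sup>2 + numerical_radius (T \<circ> T))"
proof -
  have T: "bounded_linear T"
    using assms(4) by (simp add: bounded_clinear_def)
  then have TT: "bounded_linear (T \<circ> T)"
    by (simp add: bounded_linear_compose o_def)
  define R where "R = 1 / 2 * (\<beta> * (onorm T)\<^sup>2 + numerical_radius (T \<circ> T))"
  have "0 \<le> R"
    unfolding R_def using numerical_radius_nonneg[OF TT] assms(3) by simp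
  \<comment> \<open>The square root turns the pointwise bound on squares into a bound on the
    supremum itself, which is squared again at the end.\<close>
  have "numerical_radius T \<le> sqrt R"
  proof (rule numerical_radius_le)
    fix x :: 'a assume x: "norm x = 1"
    have "norm (T x) * norm (cadjoint T x) \<le> norm (T x) * (\<beta> * norm (T x))"
      using assms(3) by (intro mult_left_mono norm_cadjoint_le[OF assms(4) _ assms(5)]) auto
    also have "\<dots> = \<beta> * (norm (T x))\<^sup>2"
      by (simp add: power2_eq_square)
    also have "\<dots> \<le> \<beta> * (onorm T)\<^sup>2"
      using onorm[OF T, of x] x assms(3) by (intro mult_left_mono power_mono) auto
    finally have 1: "norm (T x) * norm (cadjoint T x) \<le> \<beta> * (onorm T)\<^sup>2" .
    have 2: "cmod (cinner (T x) (cadjoint T x)) \<le> numerical_radius (T \<circ> T)"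
      using cmod_cinner_le_numerical_radius[OF TT x]
      by (simp add: cinner_cadjoint[OF assms(4), symmetric])
    \<comment> \<open>Moving the adjoint across makes both factors equal to <Tx,x>, which is the
      product form that \<open>Buzano\<close> bounds.\<close>
    have "2 * (cmod (cinner (T x) x))\<^sup>2 = 2 * cmod (cinner (T x) x * cinner x (cadjoint T x))"
      by (simp add: cinner_cadjoint[OF assms(4), symmetric] norm_mult power2_eq_square)
    also have "\<dots> \<le> cmod (cinner (T x) (cadjoint T x)) + norm (T x) * norm (cadjoint T x)"
      by (rule Buzano[OF x])
    also have "\<dots> \<le> numerical_radius (T \<circ> T) + \<beta> * (onorm T)\<^sup>2"
      using 2 1 by (rule add_mono)
    finally have "(cmod (cinner (T x) x))\<^sup>2 \<le> R"
      unfolding R_def by argo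
    then show "cmod (cinner (T x) x) \<le> sqrt R"
      by (rule real_le_rsqrt)
  qed (use \<open>0 \<le> R\<close> in simp)
  then have "(numerical_radius T)\<^sup>2 \<le> (sqrt R)\<^sup>2"
    using numerical_radius_nonneg[OF T] by (rule power_mono)
  then show ?thesis
    using \<open>0 \<le> R\<close> by (simp add: R_def)
qed

end
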